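(* Let $\mathcal{H}=\langle L,N,C,r\rangle$ be a totally ordered hierarchical abstract normative system and let $\mathcal{F}=(\mathit{Arg}(\mathcal{H}),\mathit{Def}(\mathcal{H},\succeq_w))$ be the argumentation framework constructed from $\mathcal{H}$ with the weakest link principle. Then $$\{\mathit{Greedy}(\mathcal{H})\}=\mathit{Outfamily}(\mathcal{F},\mathit{stb}).$$
   Context: A hierarchical abstract normative system is a tuple $\mathcal{H}=\langle L,N,C,r\rangle$ where: $L=\mathrm{E}\cup\{\neg e\mid e\in \mathrm{E}\}\cup\{\top\}$ for a finite set $\mathrm{E}$ of atomic elements; $N\subseteq L\times L$ is a finite set of norms; $C\subseteq L$ (the context) satisfies $\top\in C$ and $\{e,\neg e\}\not\subseteq C$ for all $e\in \mathrm{E}$; and $r:N\to\mathbb{N}$. For norms $u,v$ write $u\le v$ iff $r(u)\le r(v)$, and $u<v$ iff $u\le v$ and $v\not\le u$. $\mathcal{H}$ is totally ordered iff $\le$ on $N$ is antisymmetric, transitive and total. For $u=(a,x)\in N$, $\mathit{ant}(u)=a$, $\mathit{cons}(u)=x$; for $S\subseteq N$, $\mathit{cons}(S)=\{\mathit{cons}(u)\mid u\in S\}$. Complement: $\overline{e}=\neg e$ and $\overline{\neg e}=e$ for $e\in \mathrm{E}$ ($\top$ has no complement). $S\subseteq L$ is consistent iff there are no $e_1,e_2\in S$ with $e_1=\overline{e_2}$. Paths. For $R\subseteq N$, a path from $x_1$ to $x_n$ with respect to $R$ is a sequence of pairwise distinct norms $(x_1,x_2),(x_2,x_3),\dots,(x_{n-1},x_n)$,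 $n\ge 2$, all in $R$; a path in $\mathcal{H}$ is a path with respect to $N$. It is consistent if $\{x_1,\dots,x_n\}$ is consistent. $R(C)$ is the set of $x\in L$ such that there is a path with respect to $R$ from an element of $C$ to $x$. Greedy (for totally ordered $\mathcal{H}$). Let $\mathit{Appl}(N,C,R)=\{(a,x)\in N\setminus R\mid a\in C\cup \mathit{cons}(R),\ \overline{x}\notin C\cup\mathit{cons}(R)\}$ (the last condition being vacuous for $x=\top$). Put $R_0=\emptyset$, $R_{i+1}=R_i\cup\{u\in \mathit{Appl}(N,C,R_i)\mid \forall v\in \mathit{Appl}(N,C,R_i): r(u)\ge r(v)\}$, $R=\bigcup_{i\ge 0}R_i$. Then $\mathit{Greedy}(\mathcal{H})=R(C)$. Arguments. $\mathit{Arg}(\mathcal{H})$ consists of context arguments, i.e. elements $a\in C$, with $concl(a)=a$, and ordinary arguments, i.e. consistent paths $\alpha=[u_1,\dots,u_n]$ in $\mathcal{H}$ from some $x\in C$ to some $y\in L$, with $concl(\alpha)=y$. The sub-arguments of $[u_1,\dots,u_n]$ are $[u_1,\dots,u_i]$, $1\le i\le n$; context arguments have no sub-arguments. Weakest link. For ordinary arguments $\alpha,\beta$ with sets of norms $\Phi_1,\Phi_2$ respectively: $\alpha\succeq_w\beta$ iff $\exists v\in\Phi_2\setminus\Phi_1$ such that $\forall u\in\Phi_1\setminus\Phi_2$, $v\le u$. Defeat. Given $\succeq$, $\alpha$ defeats $\beta$ iff $\beta$ has a sub-argument $\beta'$ with $concl(\alpha)=\overline{concl(\beta')}$ and either $\alpha$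 is a context argument, or $\alpha$ is an ordinary argument and $\alpha\succeq\beta'$. $\mathit{Def}(\mathcal{H},\succeq)\subseteq \mathit{Arg}(\mathcal{H})\times\mathit{Arg}(\mathcal{H})$ is the resulting defeat relation. Semantics. For $\mathcal{F}=(\mathcal{A},\mathcal{R})$, $B\subseteq\mathcal{A}$ is a stable extension iff there are no $\alpha,\beta\in B$ with $(\alpha,\beta)\in\mathcal{R}$ and every $\alpha\in\mathcal{A}\setminus B$ has some $\beta\in B$ with $(\beta,\alpha)\in\mathcal{R}$; $\mathit{stb}(\mathcal{F})$ is the set of stable extensions. $\mathit{Outfamily}(\mathcal{F},\mathit{stb})=\{\{concl(\alpha)\mid\alpha\in S,\ \alpha\text{ an ordinary argument}\}\mid S\in\mathit{stb}(\mathcal{F})\}$. *)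

theory Defs
  imports Main
begin

datatype 'a lit = Atom 'a | Neg 'a | Top

type_synonym 'a norm = "'a lit \<times> 'a lit"

abbreviation ant :: "'a norm \<Rightarrow> 'a lit" where "ant \<equiv> fst"
abbreviation cons :: "'a norm \<Rightarrow> 'a lit" where "cons \<equiv> snd"

definition lang :: "'a set \<Rightarrow> 'a lit set" where
  "lang E = Atom ` E \<union> Neg ` E \<union> {Top}"

text \<open>\<^const>\<open>Top\<close> has no complement, hence the option type.\<close>

fun compl :: "'a lit \<Rightarrow> 'a lit option" where
  "compl (Atom e) = Some (Neg e)"
| "compl (Neg e) = Some (Atom e)"
| "compl Top = None"

definition consistent :: "'a lit set \<Rightarrow> bool" where
  "consistent S \<longleftrightarrow> \<not> (\<exists>e1\<in>S. \<exists>e2\<in>S. compl e2 = Some e1)"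

text \<open>The language $L$ of a system is \<open>lang (atoms H)\<close>. The ranking is a total HOL function;
  only its values on \<open>norms H\<close> are ever relevant.\<close>

record 'a hans =
  atoms :: "'a set"
  norms :: "'a norm set"
  ctx :: "'a lit set"
  rank :: "'a norm \<Rightarrow> nat"

definition hierarchical_system :: "'a hans \<Rightarrow> bool" where
  "hierarchical_system H \<longleftrightarrow>
     finite (atoms H) \<and>
     norms H \<subseteq> lang (atoms H) \<times> lang (atoms H) \<and> finite (norms H) \<and>
     ctx H \<subseteq> lang (atoms H) \<and> Top \<in> ctx H \<and>
     (\<forall>e\<in>atoms H. \<not> {Atom e, Neg e} \<subseteq> ctx H)"

definition norm_le :: "'a hans \<Rightarrow> 'a norm \<Rightarrow> 'a norm \<Rightarrow> bool" where
  "norm_le H u v \<longleftrightarrow> rank H u \<le> rank H v"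

definition totally_ordered :: "'a hans \<Rightarrow> bool" where
  "totally_ordered H \<longleftrightarrow>
     antisymp_on (norms H) (norm_le H) \<and>
     transp_on (norms H) (norm_le H) \<and>
     totalp_on (norms H) (norm_le H)"

definition path :: "'a norm set \<Rightarrow> 'a lit \<Rightarrow> 'a norm list \<Rightarrow> 'a lit \<Rightarrow> bool" where
  "path R x us y \<longleftrightarrow>
     us \<noteq> [] \<and> distinct us \<and> set us \<subseteq> R \<and>
     successively (\<lambda>u v. cons u = ant v) us \<and>
     ant (hd us) = x \<and> cons (last us) = y"

definition path_elements :: "'a norm list \<Rightarrow> 'a lit set" where
  "path_elements us = ant ` set us \<union> cons ` set us"

text \<open>The set $R(C)$.\<close>

definition reach :: "'a norm set \<Rightarrow> 'a lit set \<Rightarrow> 'a lit set" where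
  "reach R C = {x. \<exists>c\<in>C. \<exists>us. path R c us x}"

definition Appl :: "'a norm set \<Rightarrow> 'a lit set \<Rightarrow> 'a norm set \<Rightarrow> 'a norm set" where
  "Appl N C R = {(a, x) \<in> N - R. a \<in> C \<union> cons ` R \<and>
     (\<forall>y. compl x = Some y \<longrightarrow> y \<notin> C \<union> cons ` R)}"

primrec greedy_stage :: "'a hans \<Rightarrow> nat \<Rightarrow> 'a norm set" where
  "greedy_stage H 0 = {}"
| "greedy_stage H (Suc i) = greedy_stage H i \<union>
     {u \<in> Appl (norms H) (ctx H) (greedy_stage H i).
        \<forall>v \<in> Appl (norms H) (ctx H) (greedy_stage H i). rank H u \<ge> rank H v}"

definition Greedy :: "'a hans \<Rightarrow> 'a lit set" where
  "Greedy H = reach (\<Union>i. greedy_stage H i) (ctx H)"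

datatype 'a argument =
    is_context: Context "'a lit"
  | is_ordinary: Ordinary "'a norm list"

fun concl :: "'a argument \<Rightarrow> 'a lit" where
  "concl (Context a) = a"
| "concl (Ordinary us) = cons (last us)"

fun arg_norms :: "'a argument \<Rightarrow> 'a norm set" where
  "arg_norms (Context a) = {}"
| "arg_norms (Ordinary us) = set us"

fun subarguments :: "'a argument \<Rightarrow> 'a argument set" where
  "subarguments (Context a) = {}"
| "subarguments (Ordinary us) = {Ordinary (take i us) | i. 1 \<le> i \<and> i \<le> length us}"

definition Arg :: "'a hans \<Rightarrow> 'a argument set" where
  "Arg H = Context ` ctx H \<union>
     {Ordinary us | us. \<exists>x\<in>ctx H. \<exists>y\<in>lang (atoms H).
        path (norms H) x us y \<and> consistent (path_elements us)}"

text \<open>Only meaningful between ordinary arguments; \<open>defeats\<close> consults it for those alone.\<close>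

definition weakest_link :: "'a hans \<Rightarrow> 'a argument \<Rightarrow> 'a argument \<Rightarrow> bool" where
  "weakest_link H \<alpha> \<beta> \<longleftrightarrow>
     (\<exists>v \<in> arg_norms \<beta> - arg_norms \<alpha>. \<forall>u \<in> arg_norms \<alpha> - arg_norms \<beta>. norm_le H v u)"

definition defeats ::
  "('a argument \<Rightarrow> 'a argument \<Rightarrow> bool) \<Rightarrow> 'a argument \<Rightarrow> 'a argument \<Rightarrow> bool" where
  "defeats succeq \<alpha> \<beta> \<longleftrightarrow>
     (\<exists>\<beta>' \<in> subarguments \<beta>. compl (concl \<beta>') = Some (concl \<alpha>) \<and>
        (is_context \<alpha> \<or> is_ordinary \<alpha> \<and> succeq \<alpha> \<beta>'))"

definition Def ::
  "'a hans \<Rightarrow> ('a argument \<Rightarrow> 'a argument \<Rightarrow> bool) \<Rightarrow> ('a argument \<times> 'a argument) set" where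
  "Def H succeq = {(\<alpha>, \<beta>) \<in> Arg H \<times> Arg H. defeats succeq \<alpha> \<beta>}"

type_synonym 'b framework = "'b set \<times> ('b \<times> 'b) set"

definition stable_extension :: "'b framework \<Rightarrow> 'b set \<Rightarrow> bool" where
  "stable_extension F B \<longleftrightarrow>
     B \<subseteq> fst F \<and>
     \<not> (\<exists>\<alpha>\<in>B. \<exists>\<beta>\<in>B. (\<alpha>, \<beta>) \<in> snd F) \<and>
     (\<forall>\<alpha> \<in> fst F - B. \<exists>\<beta>\<in>B. (\<beta>, \<alpha>) \<in> snd F)"

definition stb :: "'b framework \<Rightarrow> 'b set set" where
  "stb F = {B. stable_extension F B}"

definition Outfamily ::
  "'a argument framework \<Rightarrow> ('a argument framework \<Rightarrow> 'a argument set set) \<Rightarrow> 'a lit set set" where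
  "Outfamily F sem = {{concl \<alpha> | \<alpha>. \<alpha> \<in> S \<and> is_ordinary \<alpha>} | S. S \<in> sem F}"

end

theory Submission
  imports Defs
begin

text \<open>
  Let \<open>R\<close> be the set of norms selected by the greedy procedure; then \<open>Greedy H = cons ` R\<close>, and the
  unique stable extension consists of the context arguments and the ordinary arguments all of whose
  norms lie in \<open>R\<close>. The weakest link comparisons rest on a special choice of paths: reaching every
  antecedent through the norm that made it available first, one obtains paths on which, at each
  stage, at most one not yet selected norm has an available antecedent. If \<open>v\<close> is selected at some
  stage, lies on such a path \<open>\<beta>\<close> and not on a competing path \<open>\<gamma>\<close>, then the first norm of \<open>\<gamma>\<close> not
  selected before \<open>v\<close> was applicable together with \<open>v\<close>; hence it ranks below \<open>v\<close>, and it does not lie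
  on \<open>\<beta>\<close>. So \<open>\<beta>\<close> always wins against \<open>\<gamma>\<close>.
\<close>

section \<open>Complements, consistency, paths and prefixes\<close>

lemma compl_sym: "compl x = Some y \<longleftrightarrow> compl y = Some x"
  by (cases x; cases y) auto

lemma consistent_subset: "consistent B \<Longrightarrow> A \<subseteq> B \<Longrightarrow> consistent A"
  unfolding consistent_def by blast

lemma consistentD: "consistent S \<Longrightarrow> x \<in> S \<Longrightarrow> y \<in> S \<Longrightarrow> compl x \<noteq> Some y"
  unfolding consistent_def by blast

lemma consistent_insert:
  assumes "consistent S" and "\<And>y. compl x = Some y \<Longrightarrow> y \<notin> S"
  shows "consistent (insert x S)"
proof -
  have "compl x \<noteq> Some x" by (cases x) auto
  moreover have "y \<notin> S" if "compl y = Some x" for y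
    using assms(2)[of y] that compl_sym[of x y] by simp
  ultimately show ?thesis using assms unfolding consistent_def by blast
qed

text \<open>Every element of a path that starts in the context thus lies in the context or is a
  consequent, so consistency can be checked there.\<close>

lemma successively_ant_in_cons:
  assumes "successively (\<lambda>u v. cons u = ant v) us" and "us \<noteq> []"
  shows "ant ` set us \<subseteq> insert (ant (hd us)) (cons ` set us)"
  using assms
proof (induction us)
  case (Cons u us)
  show ?case
  proof (cases "us = []")
    case False
    then have "cons u = ant (hd us)" "successively (\<lambda>u v. cons u = ant v) us"
      using Cons.prems(1) by (auto simp: successively_Cons)
    then have "ant ` set us \<subseteq> insert (cons u) (cons ` set us)" using Cons.IH False by simp
    then show ?thesis by auto
  qed simp
qed simp

lemma Appl_iff:
  "u \<in> Appl N C A \<longleftrightarrow> u \<in> N - A \<and> ant u \<in> C \<union> cons ` A \<and>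
     (\<forall>y. compl (cons u) = Some y \<longrightarrow> y \<notin> C \<union> cons ` A)"
  by (cases u) (simp add: Appl_def)

text \<open>The norm before the first one outside \<open>A\<close> supplies its antecedent. With
  \<open>A\<close> a stage or all selected norms, that first norm is applicable unless its
  consequent is opposed.\<close>

lemma path_first_outside:
  assumes "successively (\<lambda>u v. cons u = ant v) us" and "ant (hd us) \<in> C"
    and "\<not> set us \<subseteq> A"
  obtains ys w zs where "us = ys @ w # zs" "w \<notin> A" "set ys \<subseteq> A" "ant w \<in> C \<union> cons ` A"
proof -
  have "\<exists>x\<in>set us. x \<notin> A" using assms(3) by blast
  from split_list_first_prop[OF this]
  obtain ys w zs where us: "us = ys @ w # zs" "w \<notin> A" "set ys \<subseteq> A"
    by blast
  have "ant w \<in> C \<union> cons ` A"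
  proof (cases "ys = []")
    case True
    then show ?thesis using us assms(2) by simp
  next
    case False
    then have "cons (last ys) = ant w" "last ys \<in> A"
      using us assms(1) last_in_set[of ys] by (auto simp: successively_append_iff)
    then have "ant w \<in> cons ` A" by force
    then show ?thesis by blast
  qed
  then show thesis using us that by blast
qed

text \<open>Sub-arguments become splittings \<open>ys @ zs\<close>, which fit induction and prefix
  reasoning better than \<open>take\<close>.\<close>

lemma defeats_Ordinary_iff:
  "defeats succeq \<alpha> (Ordinary us) \<longleftrightarrow>
     (\<exists>ys zs. us = ys @ zs \<and> ys \<noteq> [] \<and> compl (cons (last ys)) = Some (concl \<alpha>) \<and>
        (is_context \<alpha> \<or> succeq \<alpha> (Ordinary ys)))"
proof -
  have prefixes: "\<beta> \<in> subarguments (Ordinary us) \<longleftrightarrow>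
      (\<exists>ys zs. us = ys @ zs \<and> ys \<noteq> [] \<and> \<beta> = Ordinary ys)"
    for \<beta> :: "'a argument"
  proof
    assume "\<beta> \<in> subarguments (Ordinary us)"
    then obtain i where i: "\<beta> = Ordinary (take i us)" "1 \<le> i" "i \<le> length us" by auto
    then have "take i us \<noteq> []" by auto
    then show "\<exists>ys zs. us = ys @ zs \<and> ys \<noteq> [] \<and> \<beta> = Ordinary ys"
      using i(1) append_take_drop_id[of i us] by metis
  next
    assume "\<exists>ys zs. us = ys @ zs \<and> ys \<noteq> [] \<and> \<beta> = Ordinary ys"
    then obtain ys zs where "\<beta> = Ordinary ys" "us = ys @ zs" "ys \<noteq> []" by blast
    then show "\<beta> \<in> subarguments (Ordinary us)"
      by (auto intro!: exI[of _ "length ys"] simp: Suc_le_eq)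
  qed
  have "is_ordinary \<alpha> \<longleftrightarrow> \<not> is_context \<alpha>" by (cases \<alpha>) auto
  then show ?thesis unfolding defeats_def Bex_def prefixes
    by (metis concl.simps(2))
qed

lemma Def_prefixI:
  assumes "\<alpha> \<in> Arg H" "Ordinary (ys @ zs) \<in> Arg H" "ys \<noteq> []"
    and "compl (cons (last ys)) = Some (concl \<alpha>)" "is_context \<alpha> \<or> succeq \<alpha> (Ordinary ys)"
  shows "(\<alpha>, Ordinary (ys @ zs)) \<in> Def H succeq"
proof -
  have "defeats succeq \<alpha> (Ordinary (ys @ zs))"
    using assms(3-5) unfolding defeats_Ordinary_iff by blast
  then show ?thesis using assms(1,2) by (simp add: Def_def)
qed

lemma not_defeats_Context: "\<not> defeats succeq \<alpha> (Context c)"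
  by (simp add: defeats_def)

section \<open>Stages of the greedy procedure\<close>

locale total_system =
  fixes H :: "'a hans"
  assumes system: "hierarchical_system H" and total: "totally_ordered H"
begin

abbreviation "N \<equiv> norms H"
abbreviation "C \<equiv> ctx H"
abbreviation "R \<equiv> greedy_stage H"

definition "greedy_norms = (\<Union>i. R i)"

lemma finite_norms: "finite N" and norms_lang: "N \<subseteq> lang (atoms H) \<times> lang (atoms H)"
  using system by (auto simp: hierarchical_system_def)

text \<open>Norms of equal rank are related by \<open>norm_le\<close> in both directions, so
  antisymmetry identifies them.\<close>

lemma rank_inj: "u \<in> N \<Longrightarrow> v \<in> N \<Longrightarrow> rank H u = rank H v \<Longrightarrow> u = v"
  using total unfolding totally_ordered_def antisymp_on_def norm_le_def by (metis order_refl)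

lemma consistent_ctx: "consistent C"
proof -
  \<comment> \<open>The system condition speaks only of \<open>atoms H\<close>; no other atom can
    occur in the context.\<close>
  have "e \<in> atoms H" if "Atom e \<in> C" for e
    using that system by (auto simp: hierarchical_system_def lang_def)
  moreover have "\<not> (Atom e \<in> C \<and> Neg e \<in> C)" if "e \<in> atoms H" for e
    using that system by (simp add: hierarchical_system_def)
  ultimately have *: "\<not> (Atom e \<in> C \<and> Neg e \<in> C)" for e by blast
  show ?thesis unfolding consistent_def
  proof clarify
    fix x y assume "x \<in> C" "y \<in> C" "compl y = Some x"
    then show False using * by (cases y) auto
  qed
qed

lemma stage_mono: "i \<le> j \<Longrightarrow> R i \<subseteq> R j"
  by (rule lift_Suc_mono_le[of R]) auto

lemma stage_norms: "R i \<subseteq> N"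
  by (induction i) (auto simp: Appl_iff)

lemma greedy_norms_subset: "greedy_norms \<subseteq> N"
  using stage_norms by (auto simp: greedy_norms_def)

lemma stage_SucD:
  assumes "u \<in> R (Suc i)" "u \<notin> R i"
  shows "u \<in> Appl N C (R i)" "v \<in> Appl N C (R i) \<Longrightarrow> rank H v \<le> rank H u"
  using assms by auto

lemma greedy_norms_entry:
  assumes "u \<in> R i"
  obtains j where "j < i" "u \<notin> R j" "u \<in> R (Suc j)"
  using assms
proof (induction i arbitrary: thesis)
  case (Suc i)
  then show ?case by (metis less_Suc_eq)
qed simp

text \<open>Norms that enter together all have the maximal rank among the applicable ones, hence
  coincide by \<open>rank_inj\<close>.\<close>

lemma stage_Suc_insert: "R (Suc i) \<subseteq> insert u (R i)" if "u \<in> R (Suc i)" "u \<notin> R i"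
proof
  fix v assume v: "v \<in> R (Suc i)"
  show "v \<in> insert u (R i)"
  proof (cases "v \<in> R i")
    case False
    then have "rank H u = rank H v"
      using stage_SucD[OF that] stage_SucD[OF v False] by (meson order_antisym)
    then show ?thesis using rank_inj stage_norms that v by blast
  qed simp
qed

text \<open>Norms enter one at a time, so two with complementary consequents cannot enter together,
  and applicability excludes a conflict with what is already available.\<close>

lemma consistent_stage: "consistent (C \<union> cons ` R i)"
proof (induction i)
  case (Suc i)
  show ?case
  proof (cases "R (Suc i) \<subseteq> R i")
    case True
    then have "C \<union> cons ` R (Suc i) \<subseteq> C \<union> cons ` R i" by blast
    then show ?thesis using Suc by (rule consistent_subset[rotated])
  next
    case False
    then obtain u where u: "u \<in> R (Suc i)" "u \<notin> R i" by blast
    have "C \<union> cons ` R (Suc i) \<subseteq> insert (cons u) (C \<union> cons ` R i)"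
      using stage_Suc_insert[OF u] by blast
    moreover have "consistent (insert (cons u) (C \<union> cons ` R i))"
      using stage_SucD(1)[OF u] unfolding Appl_iff by (blast intro: consistent_insert[OF Suc])
    ultimately show ?thesis by (rule consistent_subset[rotated])
  qed
qed (simp add: consistent_ctx)

text \<open>Each selected norm has a stage containing it; as \<open>N\<close> is finite, the maximum
  of these stages serves them all.\<close>

lemma greedy_norms_eq_stage: obtains i where "greedy_norms = R i"
proof -
  have "finite greedy_norms" using greedy_norms_subset finite_norms by (rule finite_subset)
  moreover have "\<forall>u\<in>greedy_norms. \<exists>i. u \<in> R i" by (simp add: greedy_norms_def)
  ultimately obtain f where f: "\<And>u. u \<in> greedy_norms \<Longrightarrow> u \<in> R (f u)" "finite greedy_norms"
    by metis
  \<comment> \<open>If nothing is selected, \<open>Max\<close> has an arbitrary value, but the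
    inclusion is then trivial.\<close>
  have "greedy_norms \<subseteq> R (Max (f ` greedy_norms))"
  proof
    fix u assume u: "u \<in> greedy_norms"
    then have "f u \<le> Max (f ` greedy_norms)" using f(2) by simp
    then show "u \<in> R (Max (f ` greedy_norms))" using f(1)[OF u] stage_mono by blast
  qed
  then have "greedy_norms = R (Max (f ` greedy_norms))" by (auto simp: greedy_norms_def)
  then show thesis using that by blast
qed

lemma consistent_greedy_norms: "consistent (C \<union> cons ` greedy_norms)"
  by (metis greedy_norms_eq_stage consistent_stage)

text \<open>Otherwise an applicable norm of maximal rank would be selected at the next
  stage.\<close>

lemma Appl_greedy_norms: "Appl N C greedy_norms = {}"
proof (rule ccontr)
  obtain i where i: "greedy_norms = R i" by (rule greedy_norms_eq_stage)
  let ?A = "Appl N C (R i)"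
  assume "Appl N C greedy_norms \<noteq> {}"
  moreover have "finite ?A" using finite_norms by (rule finite_subset[rotated]) (auto simp: Appl_iff)
  ultimately obtain u where "u \<in> ?A" "rank H u = Max (rank H ` ?A)" "finite ?A"
    using i obtains_MAX by metis
  then have "u \<in> ?A" "u \<in> R (Suc i)" by auto
  moreover have "u \<notin> greedy_norms" using \<open>u \<in> ?A\<close> i unfolding Appl_iff by blast
  ultimately show False unfolding greedy_norms_def by blast
qed

section \<open>Canonical paths\<close>

definition canonical :: "'a norm list \<Rightarrow> bool" where
  "canonical us \<longleftrightarrow> (\<forall>j. \<forall>v\<in>set us - R j. \<forall>w\<in>set us - R j.
     ant v \<in> C \<union> cons ` R j \<longrightarrow> ant w \<in> C \<union> cons ` R j \<longrightarrow> v = w)"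

text \<open>Strong induction on the stage: take the least stage \<open>k\<close> at which
  \<open>ant u\<close> is available and a norm \<open>w\<close> that made it so, and extend the path
  for \<open>w\<close> by \<open>u\<close>. Norms stay distinct because the earlier ones lie in
  \<open>R i\<close> and \<open>u\<close> does not.\<close>

lemma canonical_path_exists:
  assumes "u \<in> Appl N C (R i)"
  obtains us where "path N (ant (hd (us @ [u]))) (us @ [u]) (cons u)" "ant (hd (us @ [u])) \<in> C"
    "set us \<subseteq> R i" "canonical (us @ [u])"
  using assms
proof (induction i arbitrary: u thesis rule: less_induct)
  case (less i)
  have u: "u \<in> N" "u \<notin> R i" "ant u \<in> C \<union> cons ` R i" using less.prems by (auto simp: Appl_iff)
  show ?case
  proof (cases "ant u \<in> C")
    case True
    then show ?thesis using u by (intro less.prems(1)[of "[]"]) (auto simp: path_def canonical_def)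
  next
    case False
    obtain k where k: "ant u \<in> C \<union> cons ` R k" "k \<le> i" "\<And>j. j < k \<Longrightarrow> ant u \<notin> C \<union> cons ` R j"
      using ex_least_nat_le[of "\<lambda>k. ant u \<in> C \<union> cons ` R k", OF u(3)] by blast
    then obtain k' where k': "k = Suc k'" using False by (cases k) auto
    obtain w where w: "w \<in> R k" "cons w = ant u" using k(1) False by auto
    \<comment> \<open>Minimality of \<open>k\<close> makes \<open>w\<close> new at stage
      \<open>k\<close>, hence applicable at \<open>k'\<close>, where the induction hypothesis is
      available.\<close>
    have "ant u \<notin> cons ` R k'" using k(3) k' by blast
    then have w_new: "w \<notin> R k'" using w(2) by (metis imageI)
    then have "w \<in> Appl N C (R k')" using w(1) k' stage_SucD(1) by blast
    then obtain ws where ws: "path N (ant (hd (ws @ [w]))) (ws @ [w]) (cons w)"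
      "ant (hd (ws @ [w])) \<in> C" "set ws \<subseteq> R k'" "canonical (ws @ [w])"
      using less.IH[of k' w] k' k(2) by (metis Suc_le_lessD)
    define us where "us = ws @ [w]"
    have sub: "set us \<subseteq> R k" using ws(3) w(1) stage_mono[of k' k] k' by (auto simp: us_def)
    have subi: "set us \<subseteq> R i" using sub stage_mono[OF k(2)] by blast
    have "canonical (us @ [u])"
      unfolding canonical_def
    proof (intro allI ballI impI)
      fix j v v'
      assume *: "v \<in> set (us @ [u]) - R j" "v' \<in> set (us @ [u]) - R j"
        "ant v \<in> C \<union> cons ` R j" "ant v' \<in> C \<union> cons ` R j"
      show "v = v'"
      proof (cases "j < k")
        case True
        then have "v \<noteq> u" "v' \<noteq> u" using k(3) * by blast+
        then have "v \<in> set us - R j" "v' \<in> set us - R j" using * by auto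
        then show ?thesis using ws(4) *(3,4) unfolding canonical_def us_def by blast
      next
        case False
        then have "set us \<subseteq> R j" using sub stage_mono[of k j] by auto
        then show ?thesis using * by auto
      qed
    qed
    moreover have "path N (ant (hd (us @ [u]))) (us @ [u]) (cons u)"
      using ws(1) subi u(1,2) w(2) by (auto simp: path_def successively_append_iff us_def)
    moreover have "ant (hd (us @ [u])) \<in> C" using ws(2) by (cases ws) (simp_all add: us_def)
    ultimately show ?thesis using subi less.prems(1) by blast
  qed
qed

text \<open>The witness is the first norm \<open>g\<close> of \<open>gs\<close> outside
  \<open>R j\<close>. Being unopposed, it competed with \<open>v\<close> and was beaten, strictly so
  because ranks are injective and \<open>v\<close> is not on \<open>gs\<close>.\<close>

lemma canonical_outweighed:
  assumes can: "canonical us" and v: "v \<in> set us" "v \<notin> set gs" "v \<in> R (Suc j)" "v \<notin> R j"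
    and gs: "successively (\<lambda>u v. cons u = ant v) gs" "ant (hd gs) \<in> C" "set gs \<subseteq> N"
    and out: "\<not> set gs \<subseteq> R j"
    and unopposed: "\<forall>g\<in>set gs. \<forall>y. compl (cons g) = Some y \<longrightarrow> y \<notin> C \<union> cons ` R j"
  obtains g where "g \<in> set gs - set us" "rank H g < rank H v"
proof -
  obtain g where g: "g \<in> set gs" "g \<notin> R j" "ant g \<in> C \<union> cons ` R j"
    using path_first_outside[OF gs(1,2) out] by (metis in_set_conv_decomp)
  then have "g \<in> Appl N C (R j)"
    using gs(3) unopposed unfolding Appl_iff by blast
  then have "rank H g \<le> rank H v" using stage_SucD(2) v by blast
  moreover have "g \<noteq> v" using g v by blast
  moreover have "g \<in> N" "v \<in> N" using g gs v stage_norms by blast+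
  ultimately have "rank H g < rank H v" using rank_inj by (metis le_neq_implies_less)
  \<comment> \<open>At stage \<open>j\<close> both \<open>g\<close> and \<open>v\<close> are
    unselected with available antecedents; on one canonical path they would coincide.\<close>
  moreover have "g \<notin> set us"
  proof
    assume "g \<in> set us"
    moreover have "ant v \<in> C \<union> cons ` R j"
      using stage_SucD(1)[OF v(3,4)] by (auto simp: Appl_iff)
    ultimately have "g = v" using can g v unfolding canonical_def by blast
    then show False using g v by blast
  qed
  ultimately show thesis using that g by blast
qed

section \<open>Arguments built from selected norms\<close>

lemma Ordinary_in_Arg_iff:
  "Ordinary us \<in> Arg H \<longleftrightarrow> us \<noteq> [] \<and> distinct us \<and> set us \<subseteq> N \<and>
     successively (\<lambda>u v. cons u = ant v) us \<and> ant (hd us) \<in> C \<and> consistent (path_elements us)"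
proof -
  have "cons (last us) \<in> lang (atoms H)" if "set us \<subseteq> N" "us \<noteq> []"
    using that norms_lang last_in_set[of us] by (metis mem_Times_iff subsetD)
  then show ?thesis by (auto simp: Arg_def path_def)
qed

lemma Context_in_Arg_iff: "Context c \<in> Arg H \<longleftrightarrow> c \<in> C"
  by (auto simp: Arg_def)

lemma Arg_prefix: "Ordinary (ys @ zs) \<in> Arg H \<Longrightarrow> ys \<noteq> [] \<Longrightarrow> Ordinary ys \<in> Arg H"
  unfolding Ordinary_in_Arg_iff
  by (auto simp: successively_append_iff path_elements_def elim: consistent_subset)

lemma ArgI_path:
  assumes "path N c us x" "c \<in> C" "consistent (C \<union> cons ` set us)"
  shows "Ordinary us \<in> Arg H"
proof -
  have "path_elements us \<subseteq> C \<union> cons ` set us"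
    using assms successively_ant_in_cons[of us] by (auto simp: path_def path_elements_def)
  then show ?thesis
    using assms consistent_subset by (auto simp: path_def Ordinary_in_Arg_iff)
qed

text \<open>Consistency follows from applicability of \<open>u\<close>: the earlier consequents lie
  in the consistent set of stage \<open>i\<close>, which lacks the complement of
  \<open>cons u\<close>.\<close>

lemma canonical_argument:
  assumes "u \<in> Appl N C (R i)"
  obtains us where "Ordinary (us @ [u]) \<in> Arg H" "set us \<subseteq> R i" "canonical (us @ [u])"
proof -
  obtain us where us: "path N (ant (hd (us @ [u]))) (us @ [u]) (cons u)" "ant (hd (us @ [u])) \<in> C"
    "set us \<subseteq> R i" "canonical (us @ [u])"
    using canonical_path_exists[OF assms] .
  have "consistent (insert (cons u) (C \<union> cons ` R i))"
    using assms unfolding Appl_iff by (blast intro: consistent_insert[OF consistent_stage])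
  then have "consistent (C \<union> cons ` set (us @ [u]))"
    by (rule consistent_subset) (use us(3) in auto)
  with us(1,2) have "Ordinary (us @ [u]) \<in> Arg H" by (rule ArgI_path)
  then show thesis using that us(3,4) by blast
qed

lemma canonical_argument_stage:
  assumes "u \<in> R (Suc i)" "u \<notin> R i"
  obtains us where "Ordinary us \<in> Arg H" "last us = u" "set us \<subseteq> R (Suc i)" "canonical us"
proof -
  obtain us where us: "Ordinary (us @ [u]) \<in> Arg H" "set us \<subseteq> R i" "canonical (us @ [u])"
    using canonical_argument[OF stage_SucD(1)[OF assms]] .
  have "set (us @ [u]) \<subseteq> R (Suc i)" using us(2) assms by auto
  then show thesis using that[of "us @ [u]"] us by simp
qed

lemma greedy_norms_stageE:
  assumes "u \<in> greedy_norms"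
  obtains i where "u \<in> R (Suc i)" "u \<notin> R i"
  using assms greedy_norms_entry unfolding greedy_norms_def by blast

lemma stage_subset_greedy_norms: "R i \<subseteq> greedy_norms"
  by (auto simp: greedy_norms_def)

lemma greedy_norms_argument:
  assumes "u \<in> greedy_norms"
  obtains us where "Ordinary us \<in> Arg H" "last us = u" "set us \<subseteq> greedy_norms"
proof -
  obtain i where "u \<in> R (Suc i)" "u \<notin> R i" using greedy_norms_stageE[OF assms] .
  then obtain us where "Ordinary us \<in> Arg H" "last us = u" "set us \<subseteq> R (Suc i)"
    using canonical_argument_stage by metis
  then show thesis using that stage_subset_greedy_norms by blast
qed

lemma Greedy_eq: "Greedy H = cons ` greedy_norms"
proof (intro equalityI subsetI)
  fix x assume "x \<in> Greedy H"
  then show "x \<in> cons ` greedy_norms"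
    unfolding Greedy_def reach_def path_def greedy_norms_def[symmetric]
    using last_in_set by blast
next
  fix x assume "x \<in> cons ` greedy_norms"
  then obtain u where u: "u \<in> greedy_norms" "x = cons u" by blast
  obtain us where us: "Ordinary us \<in> Arg H" "last us = u" "set us \<subseteq> greedy_norms"
    using greedy_norms_argument[OF u(1)] .
  then have "path greedy_norms (ant (hd us)) us x" "ant (hd us) \<in> C"
    using us u by (auto simp: Ordinary_in_Arg_iff path_def)
  then show "x \<in> Greedy H" unfolding Greedy_def reach_def greedy_norms_def[symmetric] by blast
qed

section \<open>Stability of the greedy extension\<close>

abbreviation "framework \<equiv> (Arg H, Def H (weakest_link H))"

definition "greedy_extension =
  Context ` C \<union> {Ordinary us | us. Ordinary us \<in> Arg H \<and> set us \<subseteq> greedy_norms}"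

lemma concl_greedy_extension:
  assumes "\<alpha> \<in> greedy_extension"
  shows "concl \<alpha> \<in> C \<union> cons ` greedy_norms"
proof (cases \<alpha>)
  case (Ordinary us)
  then have "last us \<in> greedy_norms"
    using assms last_in_set by (auto simp: greedy_extension_def Ordinary_in_Arg_iff)
  then show ?thesis using Ordinary by simp
qed (use assms in \<open>auto simp: greedy_extension_def\<close>)

text \<open>The required norm is a lowest-ranked \<open>v\<close> of the attacked path off
  \<open>us\<close>. For each \<open>u\<close> on \<open>us\<close> alone,
  \<open>canonical_outweighed\<close> supplies a norm ranking below \<open>u\<close> but not below
  \<open>v\<close>.\<close>

lemma weakest_link_of_canonical:
  assumes us: "canonical us" "set us \<subseteq> R (Suc i)" and gs: "Ordinary (ys @ [w]) \<in> Arg H"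
    and new: "w \<notin> greedy_norms" and old: "set ys \<subseteq> greedy_norms"
    and unopposed_new: "\<And>y. compl (cons w) = Some y \<Longrightarrow> y \<notin> C \<union> cons ` R i"
  shows "weakest_link H (Ordinary us) (Ordinary (ys @ [w]))"
proof -
  let ?gs = "ys @ [w]"
  have gs': "successively (\<lambda>u v. cons u = ant v) ?gs" "ant (hd ?gs) \<in> C" "set ?gs \<subseteq> N"
    using gs unfolding Ordinary_in_Arg_iff by blast+
  have "set us \<subseteq> greedy_norms" using us stage_subset_greedy_norms by blast
  then have "w \<in> set ?gs - set us" using new by auto
  then obtain v where v: "v \<in> set ?gs - set us" "\<And>g. g \<in> set ?gs - set us \<Longrightarrow> rank H v \<le> rank H g"
    using ex_has_least_nat[of "\<lambda>g. g \<in> set ?gs - set us" w "rank H"] by auto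
  have "rank H v \<le> rank H u" if u: "u \<in> set us - set ?gs" for u
  proof -
    \<comment> \<open>The bound on \<open>j\<close> makes \<open>R j\<close> a subset of
      \<open>R i\<close>, where the consequent of \<open>w\<close> is still unopposed.\<close>
    obtain j where j: "j < Suc i" "u \<notin> R j" "u \<in> R (Suc j)"
      using greedy_norms_entry[of u "Suc i"] u us by blast
    have out: "\<not> set ?gs \<subseteq> R j" using new stage_subset_greedy_norms by auto
    have unopposed: "\<forall>g\<in>set ?gs. \<forall>y. compl (cons g) = Some y \<longrightarrow> y \<notin> C \<union> cons ` R j"
    proof (intro ballI allI impI)
      fix g y assume that: "g \<in> set ?gs" "compl (cons g) = Some y"
      show "y \<notin> C \<union> cons ` R j"
      proof (cases "g = w")
        case True
        then show ?thesis using unopposed_new that stage_mono[of j i] j by auto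
      next
        case False
        \<comment> \<open>All norms before \<open>w\<close> are selected, and selected consequents
          are consistent with each other and the context.\<close>
        then have "cons g \<in> C \<union> cons ` greedy_norms" using that(1) old by auto
        then have "y \<notin> C \<union> cons ` greedy_norms"
          using consistentD[OF consistent_greedy_norms] that by blast
        then show ?thesis using stage_subset_greedy_norms by blast
      qed
    qed
    obtain g where "g \<in> set ?gs - set us" "rank H g < rank H u"
      using canonical_outweighed[OF us(1) _ _ j(3,2) gs'(1-3) out unopposed] u by blast
    then show ?thesis using v(2)[of g] by simp
  qed
  then show ?thesis using v(1) unfolding weakest_link_def norm_le_def arg_norms.simps by blast
qed

text \<open>Conflict-freeness is consistency of the selected consequents with the context. An
  outside argument is attacked at its first unselected norm \<open>w\<close>: its antecedent is
  available, yet it is not applicable in the end, so its consequent is opposed.\<close>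

lemma stable_greedy_extension: "stable_extension framework greedy_extension"
proof -
  have sub: "greedy_extension \<subseteq> Arg H"
    by (auto simp: greedy_extension_def Context_in_Arg_iff)
  have free: "(\<alpha>, \<beta>) \<notin> Def H (weakest_link H)"
    if \<alpha>: "\<alpha> \<in> greedy_extension" and \<beta>: "\<beta> \<in> greedy_extension" for \<alpha> \<beta>
  proof (cases \<beta>)
    case (Ordinary us)
    show ?thesis
    proof
      assume "(\<alpha>, \<beta>) \<in> Def H (weakest_link H)"
      then obtain ys zs where ys: "us = ys @ zs" "ys \<noteq> []"
        "compl (cons (last ys)) = Some (concl \<alpha>)"
        using Ordinary by (auto simp: Def_def defeats_Ordinary_iff)
      then have "last ys \<in> greedy_norms"
        using \<beta> Ordinary last_in_set[of ys] by (auto simp: greedy_extension_def)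
      then show False
        using consistentD[OF consistent_greedy_norms _ concl_greedy_extension[OF \<alpha>]] ys(3) by blast
    qed
  qed (simp add: Def_def not_defeats_Context)
  have "\<exists>\<alpha>\<in>greedy_extension. (\<alpha>, \<beta>) \<in> Def H (weakest_link H)"
    if \<beta>: "\<beta> \<in> Arg H - greedy_extension" for \<beta>
  proof (cases \<beta>)
    case (Context c)
    then show ?thesis using \<beta> by (auto simp: greedy_extension_def Context_in_Arg_iff)
  next
    case (Ordinary us)
    then have us: "Ordinary us \<in> Arg H" "\<not> set us \<subseteq> greedy_norms"
      using \<beta> by (auto simp: greedy_extension_def)
    then have "successively (\<lambda>u v. cons u = ant v) us" "ant (hd us) \<in> C"
      by (auto simp: Ordinary_in_Arg_iff)
    then obtain ys w zs where ws: "us = ys @ w # zs" "w \<notin> greedy_norms" "set ys \<subseteq> greedy_norms"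
      "ant w \<in> C \<union> cons ` greedy_norms"
      using path_first_outside us(2) by blast
    have "w \<in> N" using us(1) ws(1) by (simp add: Ordinary_in_Arg_iff)
    moreover have "w \<notin> Appl N C greedy_norms" using Appl_greedy_norms by simp
    ultimately obtain y where y: "compl (cons w) = Some y" "y \<in> C \<union> cons ` greedy_norms"
      using ws by (cases w) (auto simp: Appl_iff)
    have pre: "Ordinary (ys @ [w]) \<in> Arg H" using Arg_prefix[of "ys @ [w]" zs] us(1) ws(1) by simp
    have us_eq: "us = (ys @ [w]) @ zs" using ws(1) by simp
    show ?thesis
    proof (cases "y \<in> C")
      case True
      then have "(Context y, \<beta>) \<in> Def H (weakest_link H)"
        using us(1) y(1) unfolding Ordinary us_eq
        by (intro Def_prefixI) (simp_all add: Context_in_Arg_iff)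
      then show ?thesis using True by (auto simp: greedy_extension_def)
    next
      case False
      obtain m where "y \<in> C \<union> cons ` R m" using y(2) by (auto simp: greedy_norms_def)
      \<comment> \<open>The first stage providing \<open>y\<close> is some \<open>Suc k\<close>, as
        \<open>y\<close> is not in the context. At \<open>k\<close> nothing opposes \<open>w\<close>
        yet, so a canonical argument for the norm entering then prevails.\<close>
      from ex_least_nat_le[of "\<lambda>i. y \<in> C \<union> cons ` R i", OF this]
      obtain i where i: "y \<in> C \<union> cons ` R i" "\<And>j. j < i \<Longrightarrow> y \<notin> C \<union> cons ` R j" by blast
      then obtain k where k: "i = Suc k" using False by (cases i) auto
      have y_new: "y \<notin> C \<union> cons ` R k" using i(2) k by blast
      obtain u where u: "u \<in> R (Suc k)" "cons u = y" using i(1) False k by blast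
      then have "u \<notin> R k" using y_new by blast
      then obtain vs where vs: "Ordinary vs \<in> Arg H" "last vs = u" "set vs \<subseteq> R (Suc k)" "canonical vs"
        using canonical_argument_stage u(1) by metis
      have "weakest_link H (Ordinary vs) (Ordinary (ys @ [w]))"
        using vs(3,4) pre ws(2,3) y(1) y_new by (intro weakest_link_of_canonical[where i = k]) auto
      then have "(Ordinary vs, \<beta>) \<in> Def H (weakest_link H)"
        using us(1) y(1) u(2) vs(1,2) unfolding Ordinary us_eq by (intro Def_prefixI) simp_all
      moreover have "set vs \<subseteq> greedy_norms" using vs(3) stage_subset_greedy_norms by blast
      then have "Ordinary vs \<in> greedy_extension" using vs(1) by (simp add: greedy_extension_def)
      ultimately show ?thesis by blast
    qed
  qed
  then show ?thesis using sub free by (auto simp: stable_extension_def)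
qed

section \<open>Uniqueness of the stable extension\<close>

lemma weakest_link_total:
  assumes \<alpha>: "Ordinary us \<in> Arg H" and \<beta>: "Ordinary vs \<in> Arg H"
    and opposed: "compl (cons (last vs)) = Some (cons (last us))"
  shows "weakest_link H (Ordinary us) (Ordinary vs) \<or> weakest_link H (Ordinary vs) (Ordinary us)"
proof -
  let ?D = "(set us - set vs) \<union> (set vs - set us)"
  have last: "last us \<in> set us" "last vs \<in> set vs" using \<alpha> \<beta> by (auto simp: Ordinary_in_Arg_iff)
  \<comment> \<open>Equal norm sets would put complementary consequents into one consistent
    argument.\<close>
  have "set us \<noteq> set vs"
  proof
    assume "set us = set vs"
    then have "cons (last us) \<in> path_elements us" "cons (last vs) \<in> path_elements us"
      using last by (auto simp: path_elements_def)
    then show False using \<alpha> opposed consistentD unfolding Ordinary_in_Arg_iff by blast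
  qed
  then obtain d where "d \<in> ?D" by blast
  \<comment> \<open>The weakest norm of the symmetric difference lies on exactly one of the two
    paths, and the other path wins.\<close>
  then obtain v where v: "v \<in> ?D" "\<And>d. d \<in> ?D \<Longrightarrow> rank H v \<le> rank H d"
    using ex_has_least_nat[of "\<lambda>d. d \<in> ?D" d "rank H"] by blast
  then show ?thesis unfolding weakest_link_def norm_le_def arg_norms.simps by blast
qed

text \<open>A member of \<open>B\<close> outside \<open>A\<close> would be attacked from
  \<open>A\<close>, hence from within \<open>B\<close>. Uniqueness thus reduces to one
  inclusion.\<close>

lemma stable_extension_subset_eq:
  assumes "stable_extension F A" "stable_extension F B" "A \<subseteq> B"
  shows "A = B"
  using assms unfolding stable_extension_def by blast

context
  fixes S
  assumes stable: "stable_extension framework S"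
begin

lemma stable_Arg: "\<alpha> \<in> S \<Longrightarrow> \<alpha> \<in> Arg H"
  using stable by (auto simp: stable_extension_def)

lemma stable_conflict_free: "\<alpha> \<in> S \<Longrightarrow> \<beta> \<in> S \<Longrightarrow> \<not> defeats (weakest_link H) \<alpha> \<beta>"
  using stable by (auto simp: stable_extension_def Def_def)

lemma stable_defeats:
  assumes "\<beta> \<in> Arg H" "\<beta> \<notin> S"
  obtains \<alpha> where "\<alpha> \<in> S" "defeats (weakest_link H) \<alpha> \<beta>"
proof -
  have "\<exists>\<alpha>\<in>S. (\<alpha>, \<beta>) \<in> Def H (weakest_link H)"
    using assms stable by (simp add: stable_extension_def)
  then show thesis using that by (auto simp: Def_def)
qed

lemma stable_Context: "c \<in> C \<Longrightarrow> Context c \<in> S"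
  using stable_defeats[of "Context c"] by (auto simp: Context_in_Arg_iff not_defeats_Context)

text \<open>A defeater of a prefix defeats the whole path as well, so \<open>S\<close> cannot
  contain one.\<close>

lemma stable_prefix:
  assumes "Ordinary (ys @ zs) \<in> S" "ys \<noteq> []"
  shows "Ordinary ys \<in> S"
proof (rule ccontr)
  assume "Ordinary ys \<notin> S"
  moreover have "Ordinary ys \<in> Arg H" using Arg_prefix stable_Arg assms by blast
  ultimately obtain \<alpha> where \<alpha>: "\<alpha> \<in> S" "defeats (weakest_link H) \<alpha> (Ordinary ys)"
    using stable_defeats by blast
  then have "defeats (weakest_link H) \<alpha> (Ordinary (ys @ zs))"
    unfolding defeats_Ordinary_iff by (metis append_assoc)
  then show False using \<alpha> assms stable_conflict_free by blast
qed

text \<open>Context arguments never oppose each other. In every other case opposition yields a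
  defeat: a context argument beats an ordinary one, and two ordinary ones are comparable by
  \<open>weakest_link_total\<close>.\<close>

lemma stable_concl_consistent: "consistent (concl ` S)"
  unfolding consistent_def
proof clarify
  fix \<alpha> \<beta> assume S: "\<alpha> \<in> S" "\<beta> \<in> S" and opposed: "compl (concl \<beta>) = Some (concl \<alpha>)"
  \<comment> \<open>Defeat is applied to the full path as its own prefix; \<open>succeq\<close> is
    here the truth value of the comparison.\<close>
  have self: "\<not> succeq" if "\<gamma> \<in> S" "Ordinary us \<in> S" "compl (cons (last us)) = Some (concl \<gamma>)"
    "succeq = (is_context \<gamma> \<or> weakest_link H \<gamma> (Ordinary us))" for \<gamma> us succeq
    using that stable_conflict_free[of \<gamma> "Ordinary us"] stable_Arg[of "Ordinary us"]
    unfolding defeats_Ordinary_iff Ordinary_in_Arg_iff by (metis append.right_neutral)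
  show False
  proof (cases \<alpha>; cases \<beta>)
    fix a b assume "\<alpha> = Context a" "\<beta> = Context b"
    moreover from this have "a \<in> C" "b \<in> C" using S stable_Arg Context_in_Arg_iff by blast+
    ultimately show False using consistentD[OF consistent_ctx, of b a] opposed by simp
  next
    fix a vs assume "\<alpha> = Context a" "\<beta> = Ordinary vs"
    then show False using self[of \<alpha> vs] S opposed by auto
  next
    fix us b assume "\<alpha> = Ordinary us" "\<beta> = Context b"
    then show False using self[of \<beta> us] S opposed compl_sym by auto
  next
    fix us vs assume *: "\<alpha> = Ordinary us" "\<beta> = Ordinary vs"
    then show False
      using self[of \<alpha> vs] self[of \<beta> us] S opposed compl_sym weakest_link_total[of us vs] stable_Arg
      by auto
  qed
qed

definition "stable_norms = \<Union> (arg_norms ` S)"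

text \<open>Cutting an argument of \<open>S\<close> right after \<open>w\<close> leaves an argument
  of \<open>S\<close> that concludes \<open>cons w\<close>.\<close>

lemma stable_norms_concl: "C \<union> cons ` stable_norms \<subseteq> concl ` S"
proof -
  have "cons w \<in> concl ` S" if "w \<in> stable_norms" for w
  proof -
    obtain us where us: "Ordinary us \<in> S" "w \<in> set us"
      using \<open>w \<in> stable_norms\<close> unfolding stable_norms_def
      by (metis UN_E argument.exhaust arg_norms.simps empty_iff)
    then obtain ys zs where "us = (ys @ [w]) @ zs" using split_list[of w us] by auto
    then have "Ordinary (ys @ [w]) \<in> S" using stable_prefix us(1) by blast
    then show ?thesis by (force intro: rev_image_eqI)
  qed
  moreover have "c \<in> concl ` S" if "c \<in> C" for c
    using stable_Context[OF that] by (force intro: rev_image_eqI)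
  ultimately show ?thesis by blast
qed

lemma stable_norms_consistent: "consistent (C \<union> cons ` stable_norms)"
  using stable_concl_consistent stable_norms_concl by (rule consistent_subset)

text \<open>A defeater in \<open>S\<close> would oppose the consequent of a norm of
  \<open>stable_norms\<close>, itself a conclusion of \<open>S\<close>.\<close>

lemma stable_argI:
  assumes "Ordinary us \<in> Arg H" "set us \<subseteq> stable_norms"
  shows "Ordinary us \<in> S"
proof (rule ccontr)
  assume "Ordinary us \<notin> S"
  then obtain \<alpha> ys zs where \<alpha>: "\<alpha> \<in> S" "us = ys @ zs" "ys \<noteq> []"
    "compl (cons (last ys)) = Some (concl \<alpha>)"
    using stable_defeats[OF assms(1)] unfolding defeats_Ordinary_iff by metis
  then have "last ys \<in> stable_norms" using assms(2) last_in_set[of ys] by auto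
  then have "cons (last ys) \<in> concl ` S" using stable_norms_concl by blast
  then show False using consistentD[OF stable_concl_consistent] \<alpha> by blast
qed

text \<open>Were a newly selected norm missing, its canonical argument would be defeated by some
  path \<open>gs\<close> of \<open>S\<close>; \<open>canonical_outweighed\<close> shows that
  \<open>gs\<close> is too weak for that.\<close>

lemma stage_stable_norms: "R i \<subseteq> stable_norms"
proof (induction i)
  case (Suc i)
  show ?case
  proof (rule ccontr)
    assume "\<not> R (Suc i) \<subseteq> stable_norms"
    then obtain u where u: "u \<in> R (Suc i)" "u \<notin> R i" "u \<notin> stable_norms" using Suc by blast
    note app = stage_SucD(1)[OF u(1,2)]
    obtain vs where vs: "Ordinary (vs @ [u]) \<in> Arg H" "set vs \<subseteq> R i" "canonical (vs @ [u])"
      using canonical_argument[OF app] .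
    define us where "us = vs @ [u]"
    have "u \<in> arg_norms (Ordinary us)" by (simp add: us_def)
    then have "Ordinary us \<notin> S" using u(3) unfolding stable_norms_def by blast
    then obtain \<alpha> where \<alpha>: "\<alpha> \<in> S" "defeats (weakest_link H) \<alpha> (Ordinary us)"
      using stable_defeats vs(1) us_def by blast
    then obtain ys zs where ys: "us = ys @ zs" "ys \<noteq> []" "compl (cons (last ys)) = Some (concl \<alpha>)"
      "is_context \<alpha> \<or> weakest_link H \<alpha> (Ordinary ys)"
      unfolding defeats_Ordinary_iff by blast
    \<comment> \<open>A proper prefix uses only norms of \<open>R i\<close>, which lie in
      \<open>stable_norms\<close> by induction, so \<open>S\<close> cannot oppose it.\<close>
    have "zs = []"
    proof (rule ccontr)
      assume "zs \<noteq> []"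
      then have "set ys \<subseteq> set vs" using ys(1) unfolding us_def by (cases zs rule: rev_cases) auto
      then have "set ys \<subseteq> stable_norms" using vs(2) Suc by blast
      then have "cons (last ys) \<in> concl ` S" using stable_norms_concl ys(2) last_in_set by blast
      then show False using consistentD[OF stable_concl_consistent] \<alpha>(1) ys(3) by blast
    qed
    then have "ys = us" using ys(1) by simp
    then have \<alpha>_new: "concl \<alpha> \<notin> C \<union> cons ` R i"
      using ys(3) app by (simp add: Appl_iff us_def)
    obtain gs where gs: "\<alpha> = Ordinary gs"
      using \<alpha>_new stable_Arg[OF \<alpha>(1)] by (cases \<alpha>) (auto simp: Context_in_Arg_iff)
    have gs_arg: "successively (\<lambda>u v. cons u = ant v) gs" "ant (hd gs) \<in> C" "set gs \<subseteq> N" "gs \<noteq> []"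
      using stable_Arg[OF \<alpha>(1)] unfolding gs Ordinary_in_Arg_iff by auto
    have gs_stable: "set gs \<subseteq> stable_norms" using \<alpha>(1) gs unfolding stable_norms_def by force
    have "weakest_link H (Ordinary gs) (Ordinary us)" using ys(4) gs \<open>ys = us\<close> by simp
    then obtain v where v: "v \<in> set us - set gs"
      "\<And>g. g \<in> set gs - set us \<Longrightarrow> rank H v \<le> rank H g"
      by (auto simp: weakest_link_def norm_le_def)
    \<comment> \<open>\<open>v\<close> need not be \<open>u\<close>; the two paths are compared at
      the stage where \<open>v\<close> entered.\<close>
    have "v \<in> R (Suc i)" using v(1) u(1) vs(2) by (auto simp: us_def)
    then obtain j where j: "j < Suc i" "v \<notin> R j" "v \<in> R (Suc j)"
      using greedy_norms_entry by blast
    have R_j: "R j \<subseteq> R i" using j(1) by (simp add: stage_mono)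
    have out: "\<not> set gs \<subseteq> R j"
    proof
      assume "set gs \<subseteq> R j"
      then have "last gs \<in> R i" using R_j gs_arg(4) last_in_set by blast
      then show False using \<alpha>_new gs by simp
    qed
    \<comment> \<open>The norms of \<open>gs\<close> and of \<open>R j\<close> all lie in
      \<open>stable_norms\<close>, whose consequents are consistent with each other and the
      context.\<close>
    have unopposed: "\<forall>g\<in>set gs. \<forall>y. compl (cons g) = Some y \<longrightarrow> y \<notin> C \<union> cons ` R j"
    proof (intro ballI allI impI)
      fix g y assume that: "g \<in> set gs" "compl (cons g) = Some y"
      have "cons g \<in> C \<union> cons ` stable_norms" using that gs_stable by blast
      then have "y \<notin> C \<union> cons ` stable_norms"
        using consistentD[OF stable_norms_consistent] that(2) by blast
      then show "y \<notin> C \<union> cons ` R j" using R_j Suc by blast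
    qed
    obtain g where "g \<in> set gs - set us" "rank H g < rank H v"
      using canonical_outweighed[OF vs(3) _ _ j(3,2) gs_arg(1-3) out unopposed] v(1) us_def by blast
    then show False using v(2)[of g] by simp
  qed
qed simp

lemma stable_eq_greedy_extension: "S = greedy_extension"
proof -
  have "greedy_norms \<subseteq> stable_norms" using stage_stable_norms by (auto simp: greedy_norms_def)
  then have "greedy_extension \<subseteq> S"
    using stable_Context stable_argI by (auto simp: greedy_extension_def)
  then show ?thesis using stable_extension_subset_eq[OF stable_greedy_extension stable] by blast
qed

end

section \<open>The output of the stable extension\<close>

lemma concl_ordinary_greedy_extension:
  "{concl \<alpha> | \<alpha>. \<alpha> \<in> greedy_extension \<and> is_ordinary \<alpha>} = cons ` greedy_norms"
proof (intro equalityI subsetI)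
  fix x assume "x \<in> {concl \<alpha> | \<alpha>. \<alpha> \<in> greedy_extension \<and> is_ordinary \<alpha>}"
  then obtain us where "x = cons (last us)" "us \<noteq> []" "set us \<subseteq> greedy_norms"
    by (auto simp: greedy_extension_def Ordinary_in_Arg_iff)
  then show "x \<in> cons ` greedy_norms" using last_in_set by blast
next
  fix x assume "x \<in> cons ` greedy_norms"
  then obtain u where u: "u \<in> greedy_norms" "x = cons u" by blast
  obtain us where us: "Ordinary us \<in> Arg H" "last us = u" "set us \<subseteq> greedy_norms"
    using greedy_norms_argument[OF u(1)] .
  then have "Ordinary us \<in> greedy_extension" by (simp add: greedy_extension_def)
  moreover have "concl (Ordinary us) = x" using us u by simp
  ultimately show "x \<in> {concl \<alpha> | \<alpha>. \<alpha> \<in> greedy_extension \<and> is_ordinary \<alpha>}"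
    using argument.disc(4) by blast
qed

end

theorem proposition6:
  fixes H :: "'a hans"
  assumes "hierarchical_system H"
    and "totally_ordered H"
  shows "{Greedy H} = Outfamily (Arg H, Def H (weakest_link H)) stb"
proof -
  interpret total_system H using assms by unfold_locales
  have "stb framework = {greedy_extension}"
    unfolding stb_def using stable_greedy_extension stable_eq_greedy_extension by blast
  then show ?thesis
    using concl_ordinary_greedy_extension Greedy_eq by (simp add: Outfamily_def)
qed

end
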